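(* Let $\alpha>1$ be real and let $$u_{2\alpha}(x,t)=\frac{1}{2(\alpha t)^{1/\alpha}}\left[\mathrm{Ai}_{\alpha}\left(\frac{x}{(\alpha t)^{1/\alpha}}\right)+\mathrm{Ai}_{\alpha}\left(-\frac{x}{(\alpha t)^{1/\alpha}}\right)\right].$$ Then for all $x\in\mathbb{R}$ and $t>0$, $$u_{2\alpha}(x,t)=\frac{1}{\alpha\pi t^{1/\alpha}}\sum_{k=0}^{\infty}\left(\frac{x}{t^{1/\alpha}}\right)^{2k}\frac{\Gamma\left(\frac{2k+1}{\alpha}\right)}{(2k)!}\sin\left(\pi\frac{(2k+1)(\alpha+1)}{2\alpha}\right).$$
   Context: For real $\alpha>1$ the generalized Airy function is $\mathrm{Ai}_{\alpha}(x)=\frac{1}{\pi}\int_0^{+\infty}\cos\left(sx+\frac{s^{\alpha}}{\alpha}\right)ds$, $x\in\mathbb{R}$ (convergent improper Riemann integral). $\Gamma$ is the Euler gamma function. *)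

theory Defs
  imports "HOL-Analysis.Analysis"
begin

text \<open>
  The integral over the half-line converges only conditionally, so it is the limit of the
  integrals over compact intervals.  The integrand is continuous on each of them
  (\<open>0 powr \<alpha> = 0\<close>), so there \<^const>\<open>integral\<close> is the Riemann integral.
\<close>

definition gen_airy :: "real \<Rightarrow> real \<Rightarrow> real" where
  "gen_airy \<alpha> x =
     1 / pi * Lim at_top (\<lambda>R. integral {0..R} (\<lambda>s. cos (s * x + s powr \<alpha> / \<alpha>)))"

text \<open>The function \<open>u\<^bsub>2\<alpha>\<^esub>\<close>; the first argument is \<open>\<alpha>\<close>, not \<open>2\<alpha>\<close>.\<close>

definition u_even :: "real \<Rightarrow> real \<Rightarrow> real \<Rightarrow> real" where
  "u_even \<alpha> x t =
     1 / (2 * (\<alpha> * t) powr (1 / \<alpha>)) *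
       (gen_airy \<alpha> (x / (\<alpha> * t) powr (1 / \<alpha>)) + gen_airy \<alpha> (- x / (\<alpha> * t) powr (1 / \<alpha>)))"

end

theory Submission
  imports Defs "HOL-Complex_Analysis.Complex_Analysis"
begin

text \<open>
  By Cauchy's theorem the integration path of \<open>exp (\<i> * (y * z + z powr \<alpha> / \<alpha>))\<close> may be turned
  from the positive real axis to the ray at angle \<open>\<theta> = pi / (2 * \<alpha>)\<close>, where the oscillating factor
  \<open>exp (\<i> * z powr \<alpha> / \<alpha>)\<close> becomes the decaying \<open>exp (- (r powr \<alpha> / \<alpha>))\<close>; the connecting arc
  contributes nothing in the limit since \<open>sin u \<ge> 2 * u / pi\<close> on \<open>{0..pi/2}\<close>.  On the ray, because
  \<open>\<alpha> > 1\<close>, the power series of \<open>exp (\<i> * y * z)\<close> may be integrated term by term, and each term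
  is a Gamma integral.  Adding the series at \<open>y\<close> and \<open>- y\<close> leaves the even powers.
\<close>

section \<open>Gamma integrals and an integrable majorant on the half-line\<close>

text \<open>Substitute \<open>t = r powr \<alpha> / \<alpha>\<close> in Euler's integral for
  \<open>Gamma (p / \<alpha>)\<close>; the prefactor clears the powers of \<alpha> that this
  produces. On the open half-line the substitution is a differentiable bijection with no endpoint to
  treat.\<close>

lemma has_integral_powr_exp_Gamma:
  fixes \<alpha> p :: real
  assumes "\<alpha> > 0" "p > 0"
  shows "((\<lambda>r. r powr (p - 1) * exp (- (r powr \<alpha> / \<alpha>))) has_integral
           \<alpha> powr (p / \<alpha> - 1) * Gamma (p / \<alpha>)) {0<..}"
proof -
  define f where "f = (\<lambda>t::real. t powr (p / \<alpha> - 1) / exp t)"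
  define g where "g = (\<lambda>r::real. r powr \<alpha> / \<alpha>)"
  have p: "p / \<alpha> > 0" using assms by simp
  have img: "g ` {0<..} = {0<..}"
  proof (intro equalityI subsetI)
    fix t :: real assume "t \<in> {0<..}"
    hence "t = g ((\<alpha> * t) powr (1 / \<alpha>))" "(\<alpha> * t) powr (1 / \<alpha>) > 0"
      using assms by (auto simp: g_def powr_powr)
    thus "t \<in> g ` {0<..}" by blast
  qed (use assms in \<open>auto simp: g_def\<close>)
  have inj: "inj_on g {0<..}"
    by (rule inj_on_inverseI[of _ "\<lambda>t. (\<alpha> * t) powr (1 / \<alpha>)"]) (use assms in \<open>auto simp: g_def powr_powr\<close>)
  have "(f has_integral Gamma (p / \<alpha>)) {0<..}"
    using Gamma_integral_real[OF p] unfolding f_def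
    by (rule iffD1[OF has_integral_spike_set_eq, rotated 2]) (auto intro: negligible_subset[of "{0}"])
  \<comment> \<open>The change of variables needs absolute integrability, which for a nonnegative
    function is just integrability.\<close>
  moreover have "f absolutely_integrable_on {0<..}"
    by (rule nonnegative_absolutely_integrable_1)
       (use calculation in \<open>auto simp: f_def has_integral_integrable\<close>)
  ultimately have "f absolutely_integrable_on g ` {0<..} \<and> integral (g ` {0<..}) f = Gamma (p / \<alpha>)"
    by (simp add: img integral_unique)
  hence "(\<lambda>r. \<bar>r powr (\<alpha> - 1)\<bar> * f (g r)) absolutely_integrable_on {0<..} \<and>
         integral {0<..} (\<lambda>r. \<bar>r powr (\<alpha> - 1)\<bar> * f (g r)) = Gamma (p / \<alpha>)"
    by (subst has_absolute_integral_change_of_variables_1'[OF _ _ inj])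
       (use assms in \<open>auto simp: g_def intro!: derivative_eq_intros\<close>)
  hence "((\<lambda>r. \<bar>r powr (\<alpha> - 1)\<bar> * f (g r)) has_integral Gamma (p / \<alpha>)) {0<..}"
    by (auto simp: has_integral_iff set_lebesgue_integral_eq_integral(1))
  from has_integral_mult_right[OF this, of "\<alpha> powr (p / \<alpha> - 1)"]
  show ?thesis
  proof (rule has_integral_eq[rotated])
    fix r :: real assume "r \<in> {0<..}"
    moreover have "(\<alpha> - 1) + \<alpha> * (p / \<alpha> - 1) = p - 1"
      using assms by (simp add: field_simps)
    ultimately show "\<alpha> powr (p / \<alpha> - 1) * (\<bar>r powr (\<alpha> - 1)\<bar> * f (g r)) =
        r powr (p - 1) * exp (- (r powr \<alpha> / \<alpha>))"
      using assms
      by (simp add: f_def g_def powr_divide powr_powr exp_minus field_simps flip: powr_add)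
  qed
qed

lemma has_integral_power_exp_Gamma:
  fixes \<alpha> :: real
  assumes "\<alpha> > 0"
  shows "((\<lambda>r. r ^ n * exp (- (r powr \<alpha> / \<alpha>))) has_integral
           \<alpha> powr ((real n + 1) / \<alpha> - 1) * Gamma ((real n + 1) / \<alpha>)) {0..}"
proof -
  \<comment> \<open>At the origin \<open>0 ^ 0 = 1\<close> but \<open>0 powr 0 = 0\<close>, so
    powers are compared on the open half-line and the null set \<open>{0}\<close> is added
    afterwards.\<close>
  have "((\<lambda>r. r ^ n * exp (- (r powr \<alpha> / \<alpha>))) has_integral
           \<alpha> powr ((real n + 1) / \<alpha> - 1) * Gamma ((real n + 1) / \<alpha>)) {0<..}"
    by (rule has_integral_eq[OF _ has_integral_powr_exp_Gamma[OF assms, of "real n + 1"]])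
       (auto simp: powr_realpow)
  thus ?thesis
    by (rule iffD1[OF has_integral_spike_set_eq, rotated 2]) (auto intro: negligible_subset[of "{0}"])
qed

text \<open>With \<open>c = norm w\<close> this is the majorant of both dominated convergence
  arguments below. Since \<alpha> > 1, the power beats every linear growth rate c.\<close>

lemma integrable_exp_minus_powr:
  fixes \<alpha> c :: real
  assumes "\<alpha> > 1"
  shows "(\<lambda>r. exp (c * r - r powr \<alpha> / \<alpha>)) integrable_on {0..}"
proof -
  \<comment> \<open>The extra 1 is what leaves the decay \<open>exp (- r)\<close> once
    \<open>\<bar>c\<bar> * r\<close> has been absorbed.\<close>
  define b where "b = \<bar>c\<bar> + 1"
  \<comment> \<open>Beyond \<open>r0\<close> the power exceeds \<open>b * r\<close>, so the integrand is at most \<open>exp (b * r0) * exp (- r)\<close>.\<close>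
  define r0 where "r0 = (\<alpha> * b) powr (1 / (\<alpha> - 1))"
  have b: "b > 0" by (simp add: b_def)
  have bd: "c * r - r powr \<alpha> / \<alpha> \<le> b * r0 - r" if "r \<ge> 0" for r
  proof (cases "r \<le> r0")
    case True
    have "c * r - r powr \<alpha> / \<alpha> \<le> \<bar>c\<bar> * r"
      using that assms by (smt (verit, best) divide_nonneg_pos powr_ge_zero mult_right_mono)
    also have "\<dots> = b * r - r" by (simp add: b_def algebra_simps)
    also have "\<dots> \<le> b * r0 - r" using True b by simp
    finally show ?thesis .
  next
    case False
    have r0: "r0 \<ge> 0" by (simp add: r0_def)
    have "\<alpha> * b = r0 powr (\<alpha> - 1)" using assms b by (simp add: r0_def powr_powr)
    also have "\<dots> \<le> r powr (\<alpha> - 1)" using False r0 assms by (intro powr_mono2) auto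
    finally have "\<alpha> * b * r \<le> r powr (\<alpha> - 1) * r" using that by (intro mult_right_mono)
    also have "\<dots> = r powr \<alpha>" using False r0 by (simp add: powr_mult_base mult.commute)
    finally have "b * r \<le> r powr \<alpha> / \<alpha>" using assms by (simp add: field_simps)
    moreover have "c * r \<le> \<bar>c\<bar> * r" using that by (intro mult_right_mono) auto
    moreover have "b * r = \<bar>c\<bar> * r + r" by (simp add: b_def algebra_simps)
    moreover have "b * r0 \<ge> 0" using b r0 by simp
    ultimately show ?thesis by linarith
  qed
  have majorant: "(\<lambda>r. exp (b * r0) * exp (- 1 * r)) integrable_on {0..}"
    by (intro integrable_on_mult_right integrable_on_exp_minus_to_infinity) auto
  have meas: "(\<lambda>r. exp (c * r - r powr \<alpha> / \<alpha>)) \<in> borel_measurable (lebesgue_on {0..})"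
    by (intro continuous_imp_measurable_on_sets_lebesgue continuous_intros continuous_on_powr') (use assms in auto)
  have le: "\<bar>exp (c * r - r powr \<alpha> / \<alpha>)\<bar> \<le> exp (b * r0) * exp (- 1 * r)" if "r \<in> {0..}" for r
    using bd[of r] that unfolding exp_add[symmetric] by simp
  show ?thesis
    by (rule measurable_bounded_by_integrable_imp_integrable_real[OF meas majorant le]) auto
qed

section \<open>Rotating the contour\<close>

text \<open>Sine is concave here, so it lies above the chord from \<open>(0, 0)\<close> to
  \<open>(pi / 2, 1)\<close>.\<close>

lemma Jordan_sin_ge:
  fixes u :: real
  assumes "0 \<le> u" "u \<le> pi / 2"
  shows "2 * u / pi \<le> sin u"
proof -
  have "convex_on {0..pi/2} (\<lambda>x. - sin x)"
    by (rule f''_ge0_imp_convex[where f' = "\<lambda>x. - cos x" and f'' = sin])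
       (auto intro!: derivative_eq_intros sin_ge_zero)
  from convex_onD[OF this, of "2 * u / pi" 0 "pi / 2"] show ?thesis
    using assms by (simp add: field_simps)
qed

text \<open>On the nonnegative reals its real part is the integrand of \<open>gen_airy\<close>. The
  principal branch suffices, because the sector used stays in the right half-plane.\<close>

definition airy_kernel :: "real \<Rightarrow> real \<Rightarrow> complex \<Rightarrow> complex" where
  "airy_kernel \<alpha> y z = exp (\<i> * (of_real y * z + z powr of_real \<alpha> / of_real \<alpha>))"

text \<open>For r > 0 the bound on the angle keeps the principal logarithm equal to
  \<open>ln r + \<i> * \<phi>\<close>; for r = 0 both sides are 0.\<close>

lemma rcis_powr_of_real:
  assumes "r \<ge> 0" "\<bar>\<phi>\<bar> < pi"
  shows "(of_real r * cis \<phi>) powr of_real \<alpha> = of_real (r powr \<alpha>) * cis (\<alpha> * \<phi>)"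
proof (cases "r = 0")
  case False
  with assms have "of_real r * cis \<phi> = exp (of_real (ln r) + \<i> * of_real \<phi>)"
    by (simp add: exp_add cis_conv_exp exp_of_real)
  moreover have "Ln (exp (of_real (ln r) + \<i> * of_real \<phi>)) = of_real (ln r) + \<i> * of_real \<phi>"
    using assms by (intro Ln_exp) auto
  ultimately show ?thesis using False assms
    by (simp add: powr_def cis_conv_exp exp_of_real[symmetric] algebra_simps flip: exp_add)
qed auto

lemma norm_airy_kernel_rcis:
  assumes "r \<ge> 0" "\<bar>\<phi>\<bar> < pi"
  shows "norm (airy_kernel \<alpha> y (of_real r * cis \<phi>)) =
           exp (- (y * r * sin \<phi>) - r powr \<alpha> / \<alpha> * sin (\<alpha> * \<phi>))"
  by (simp add: airy_kernel_def rcis_powr_of_real[OF assms])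

lemma airy_kernel_on_ray:
  assumes "\<alpha> > 1" "r \<ge> 0"
  shows "airy_kernel \<alpha> y (of_real r * cis (pi / (2 * \<alpha>))) =
           exp (\<i> * of_real y * cis (pi / (2 * \<alpha>)) * of_real r) * of_real (exp (- (r powr \<alpha> / \<alpha>)))"
proof -
  have "\<bar>pi / (2 * \<alpha>)\<bar> < pi" using assms by (simp add: field_simps)
  thus ?thesis using assms
    by (simp add: airy_kernel_def rcis_powr_of_real exp_of_real[symmetric] algebra_simps flip: exp_add)
qed

text \<open>At the boundary point 0 continuity comes from the positive exponent, since z powr
  \<alpha> tends to 0 there.\<close>

lemma continuous_on_airy_kernel:
  assumes "\<alpha> > 0"
  shows "continuous_on {z. Re z \<ge> 0} (airy_kernel \<alpha> y)"
  unfolding airy_kernel_def by (intro continuous_intros) (use assms in auto)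

text \<open>
  The half-plane is convex and contains the whole sector, and the kernel is continuous on it up to
  the branch point \<open>0\<close>; so a primitive exists there and no indentation of the path is needed.
\<close>

lemma airy_kernel_primitive:
  assumes "\<alpha> > 0"
  obtains F where "\<And>z. Re z \<ge> 0 \<Longrightarrow> (F has_field_derivative airy_kernel \<alpha> y z) (at z within {z. Re z \<ge> 0})"
proof -
  have conv: "convex {z. Re z \<ge> 0}" using convex_halfspace_Re_ge[of 0] by simp
  have "airy_kernel \<alpha> y field_differentiable at z" if "z \<in> interior {z. Re z \<ge> 0} - {}" for z
  proof -
    have "z \<in> {z. Re z > 0}" using that interior_halfspace_ge[of "1::complex" 0] by simp
    moreover have "airy_kernel \<alpha> y holomorphic_on {z. Re z > 0}"
      unfolding airy_kernel_def
      by (intro holomorphic_intros) (use assms in \<open>auto simp: complex_nonpos_Reals_iff\<close>)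
    ultimately show ?thesis
      by (auto intro!: holomorphic_on_imp_differentiable_at open_halfspace_Re_gt)
  qed
  from holomorphic_convex_primitive[OF conv finite.emptyI continuous_on_airy_kernel[OF assms] this] obtain F where
    "\<And>z. z \<in> {z. Re z \<ge> 0} \<Longrightarrow> (F has_field_derivative airy_kernel \<alpha> y z) (at z within {z. Re z \<ge> 0})"
    by auto
  thus ?thesis by (intro that[of F]) simp
qed

text \<open>Segment, ray and arc bound a sector inside the right half-plane, so each integral is a
  difference of values of one primitive F, and these cancel around the boundary.\<close>

lemma airy_kernel_rotate:
  assumes "\<alpha> > 1" "R \<ge> 0"
  defines "\<theta> \<equiv> pi / (2 * \<alpha>)"
  shows "integral {0..R} (\<lambda>s. airy_kernel \<alpha> y (of_real s)) =
           cis \<theta> * integral {0..R} (\<lambda>r. airy_kernel \<alpha> y (of_real r * cis \<theta>))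
           - integral {0..\<theta>} (\<lambda>\<phi>. \<i> * of_real R * cis \<phi> * airy_kernel \<alpha> y (of_real R * cis \<phi>))"
proof -
  have \<theta>: "0 < \<theta>" "\<theta> < pi / 2" using assms by (auto simp: \<theta>_def field_simps)
  have cos: "cos \<phi> \<ge> 0" if "\<phi> \<in> {0..\<theta>}" for \<phi>
    using that \<theta> by (intro cos_ge_zero) auto
  obtain F where F: "\<And>z. Re z \<ge> 0 \<Longrightarrow> (F has_field_derivative airy_kernel \<alpha> y z) (at z within {z. Re z \<ge> 0})"
    using airy_kernel_primitive[of \<alpha> y] assms by auto
  \<comment> \<open>One path formula serves all three pieces. A derivative of F within the
    half-plane is enough, as the paths never leave it.\<close>
  have ftc: "((\<lambda>t. p' t * airy_kernel \<alpha> y (p t)) has_integral F (p b) - F (p a)) {a..b}"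
    if "a \<le> b" and deriv: "\<And>t. t \<in> {a..b} \<Longrightarrow> (p has_vector_derivative p' t) (at t within {a..b})"
       and nonneg: "\<And>t. t \<in> {a..b} \<Longrightarrow> Re (p t) \<ge> 0" for p p' and a b :: real
  proof -
    have "((F \<circ> p) has_vector_derivative p' t * airy_kernel \<alpha> y (p t)) (at t within {a..b})"
      if t: "t \<in> {a..b}" for t
      by (intro field_vector_diff_chain_within deriv t DERIV_subset[OF F])
         (use t nonneg in auto)
    from fundamental_theorem_of_calculus[OF that(1) this] show ?thesis by simp
  qed
  have 1: "((\<lambda>s. 1 * airy_kernel \<alpha> y (of_real s)) has_integral F (of_real R) - F (of_real 0)) {0..R}"
    by (rule ftc) (use assms in \<open>auto intro!: derivative_eq_intros\<close>)
  have 2: "((\<lambda>r. cis \<theta> * airy_kernel \<alpha> y (of_real r * cis \<theta>)) has_integral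
             F (of_real R * cis \<theta>) - F (of_real 0 * cis \<theta>)) {0..R}"
    by (rule ftc) (use assms(2) cos[of \<theta>] \<theta> in \<open>auto intro!: derivative_eq_intros\<close>)
  have 3: "((\<lambda>\<phi>. \<i> * of_real R * cis \<phi> * airy_kernel \<alpha> y (of_real R * cis \<phi>)) has_integral
             F (of_real R * cis \<theta>) - F (of_real R * cis 0)) {0..\<theta>}"
  proof (rule ftc)
    show "((\<lambda>\<phi>. of_real R * cis \<phi>) has_vector_derivative \<i> * of_real R * cis \<phi>) (at \<phi> within {0..\<theta>})" for \<phi>
      unfolding cis_conv_exp
      by (rule has_vector_derivative_real_field) (auto intro!: derivative_eq_intros)
  qed (use \<theta> cos assms(2) in auto)
  show ?thesis
    using integral_unique[OF 1] integral_unique[OF 2] integral_unique[OF 3] by simp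
qed

text \<open>The integrand is bounded by \<open>R * exp (- (R * L R) * \<phi>)\<close>, whose
  integral is at most \<open>1 / L R\<close>; and \<open>L R\<close> grows like a positive power of
  R.\<close>

lemma airy_kernel_arc_tendsto_0:
  assumes "\<alpha> > 1"
  defines "\<theta> \<equiv> pi / (2 * \<alpha>)"
  shows "((\<lambda>R. integral {0..\<theta>} (\<lambda>\<phi>. \<i> * of_real R * cis \<phi> * airy_kernel \<alpha> y (of_real R * cis \<phi>)))
           \<longlongrightarrow> 0) at_top"
proof -
  have \<theta>: "0 < \<theta>" "\<theta> < pi / 2" "\<alpha> * \<theta> = pi / 2" using assms by (auto simp: \<theta>_def field_simps)
  \<comment> \<open>\<open>R * L R\<close> is the decay rate in \<phi>: Jordan's inequality gives
    \<open>2 / pi * R powr \<alpha>\<close>, and the linear phase costs at most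
    \<open>\<bar>y\<bar> * R\<close>.\<close>
  define L where "L = (\<lambda>R::real. 2 / pi * R powr (\<alpha> - 1) - \<bar>y\<bar>)"
  have "filterlim (\<lambda>R::real. R powr (\<alpha> - 1)) at_top at_top"
    unfolding filterlim_at_top_gt[where c = 0]
  proof (intro allI impI)
    fix Z :: real assume "Z > 0"
    have "Z \<le> R powr (\<alpha> - 1)" if "R \<ge> Z powr (1 / (\<alpha> - 1))" for R
      using powr_mono2[of "\<alpha> - 1" "Z powr (1 / (\<alpha> - 1))" R] assms(1) \<open>Z > 0\<close> that
      by (simp add: powr_powr)
    thus "eventually (\<lambda>R. Z \<le> R powr (\<alpha> - 1)) at_top"
      by (rule eventually_mono[OF eventually_ge_at_top])
  qed
  hence L_lim: "filterlim L at_top at_top"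
    unfolding L_def diff_conv_add_uminus
    by (subst add.commute)
       (intro filterlim_tendsto_add_at_top[OF tendsto_const] filterlim_tendsto_pos_mult_at_top[OF tendsto_const], auto)
  have bound: "norm (integral {0..\<theta>} (\<lambda>\<phi>. \<i> * of_real R * cis \<phi> * airy_kernel \<alpha> y (of_real R * cis \<phi>)))
                 \<le> 1 / L R" if R: "R > 0" "L R > 0" for R
  proof -
    have RL: "R * L R = 2 / pi * R powr \<alpha> - \<bar>y\<bar> * R"
      using R powr_mult_base[of R "\<alpha> - 1"] by (simp add: L_def algebra_simps)
    have int: "((\<lambda>\<phi>. R * exp (- (R * L R) * \<phi>)) has_integral
                 - exp (- (R * L R) * \<theta>) / L R - (- exp (- (R * L R) * 0) / L R)) {0..\<theta>}"
    proof (rule fundamental_theorem_of_calculus)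
      fix \<phi> assume "\<phi> \<in> {0..\<theta>}"
      have "((\<lambda>\<phi>. - exp (- (R * L R) * \<phi>) / L R) has_real_derivative R * exp (- (R * L R) * \<phi>))
              (at \<phi> within {0..\<theta>})"
        using R by (auto intro!: derivative_eq_intros)
      thus "((\<lambda>\<phi>. - exp (- (R * L R) * \<phi>) / L R) has_vector_derivative R * exp (- (R * L R) * \<phi>))
              (at \<phi> within {0..\<theta>})"
        by (simp add: has_real_derivative_iff_has_vector_derivative)
    qed (use \<theta> in simp)
    have "norm (integral {0..\<theta>} (\<lambda>\<phi>. \<i> * of_real R * cis \<phi> * airy_kernel \<alpha> y (of_real R * cis \<phi>)))
            \<le> integral {0..\<theta>} (\<lambda>\<phi>. R * exp (- (R * L R) * \<phi>))"
    proof (rule integral_norm_bound_integral)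
      show "(\<lambda>\<phi>. \<i> * of_real R * cis \<phi> * airy_kernel \<alpha> y (of_real R * cis \<phi>)) integrable_on {0..\<theta>}"
      proof (intro integrable_continuous_interval continuous_on_mult)
        show "continuous_on {0..\<theta>} (\<lambda>\<phi>. airy_kernel \<alpha> y (of_real R * cis \<phi>))"
        proof (rule continuous_on_compose2[OF continuous_on_airy_kernel])
          show "(\<lambda>\<phi>. of_real R * cis \<phi>) ` {0..\<theta>} \<subseteq> {z. Re z \<ge> 0}"
          proof (intro image_subsetI CollectI)
            fix \<phi> assume "\<phi> \<in> {0..\<theta>}"
            hence "cos \<phi> \<ge> 0" using \<theta> by (intro cos_ge_zero) auto
            thus "Re (of_real R * cis \<phi>) \<ge> 0" using R by simp
          qed
        qed (use assms(1) in \<open>auto intro!: continuous_intros\<close>)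
      qed (auto intro!: continuous_intros)
      show "(\<lambda>\<phi>. R * exp (- (R * L R) * \<phi>)) integrable_on {0..\<theta>}"
        using int by blast
      fix \<phi> assume \<phi>: "\<phi> \<in> {0..\<theta>}"
      have "\<alpha> * \<phi> \<le> pi / 2"
        using \<phi> assms(1) by (simp flip: \<theta>(3))
      hence "2 * (\<alpha> * \<phi>) / pi \<le> sin (\<alpha> * \<phi>)" using \<phi> assms(1) by (intro Jordan_sin_ge) auto
      hence "R powr \<alpha> / \<alpha> * (2 * (\<alpha> * \<phi>) / pi) \<le> R powr \<alpha> / \<alpha> * sin (\<alpha> * \<phi>)"
        using assms(1) by (intro mult_left_mono) auto
      moreover have "R powr \<alpha> / \<alpha> * (2 * (\<alpha> * \<phi>) / pi) = 2 / pi * R powr \<alpha> * \<phi>"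
        using assms(1) by simp
      \<comment> \<open>For negative y this term grows with R;
        \<open>\<bar>sin \<phi>\<bar> \<le> \<phi>\<close> keeps it proportional to \<phi>, so that
        the decay can absorb it.\<close>
      moreover have "- (y * R * sin \<phi>) \<le> \<bar>y\<bar> * R * \<phi>"
      proof -
        have "- (y * R * sin \<phi>) \<le> \<bar>y * R * sin \<phi>\<bar>" by linarith
        also have "\<dots> = \<bar>y\<bar> * R * \<bar>sin \<phi>\<bar>" using R by (simp add: abs_mult)
        also have "\<dots> \<le> \<bar>y\<bar> * R * \<phi>"
          using R \<phi> abs_sin_x_le_abs_x[of \<phi>] by (intro mult_left_mono) auto
        finally show ?thesis .
      qed
      ultimately have "- (y * R * sin \<phi>) - R powr \<alpha> / \<alpha> * sin (\<alpha> * \<phi>) \<le> - (R * L R) * \<phi>"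
        unfolding RL by (simp add: algebra_simps)
      thus "norm (\<i> * of_real R * cis \<phi> * airy_kernel \<alpha> y (of_real R * cis \<phi>)) \<le> R * exp (- (R * L R) * \<phi>)"
        using R \<phi> \<theta> by (simp add: norm_mult norm_airy_kernel_rcis)
    qed
    also have "\<dots> = (1 - exp (- (R * L R) * \<theta>)) / L R"
      using integral_unique[OF int] by (simp add: diff_divide_distrib)
    also have "\<dots> \<le> 1 / L R" using R by (intro divide_right_mono) auto
    finally show ?thesis .
  qed
  have "((\<lambda>R. 1 / L R) \<longlongrightarrow> 0) at_top"
    using tendsto_inverse_0_at_top[OF L_lim] by (simp add: inverse_eq_divide)
  moreover have "eventually (\<lambda>R. R > 0 \<and> L R > 0) at_top"
    using L_lim by (intro eventually_conj eventually_gt_at_top) (simp add: filterlim_at_top_dense)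
  hence "eventually (\<lambda>R. norm (integral {0..\<theta>} (\<lambda>\<phi>. \<i> * of_real R * cis \<phi> * airy_kernel \<alpha> y (of_real R * cis \<phi>)))
                 \<le> 1 / L R) at_top"
    by eventually_elim (use bound in auto)
  ultimately show ?thesis
    by (rule Lim_null_comparison[rotated])
qed

section \<open>Dominated convergence and the series on the ray\<close>

text \<open>Along any sequence of endpoints tending to infinity, extend the truncations of f by 0.
  At each point they eventually equal f, and h dominates them all.\<close>

lemma integral_tendsto_at_top_dominated:
  fixes f :: "real \<Rightarrow> complex"
  assumes f: "continuous_on {a..} f" and h: "h integrable_on {a..}"
    and le: "\<And>x. x \<ge> a \<Longrightarrow> norm (f x) \<le> h x"
  shows "((\<lambda>R. integral {a..R} f) \<longlongrightarrow> integral {a..} f) at_top"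
proof (rule tendsto_at_topI_sequentially)
  fix X :: "nat \<Rightarrow> real" assume X: "filterlim X at_top sequentially"
  have h0: "h x \<ge> 0" if "x \<ge> a" for x
    using le[OF that] norm_ge_zero[of "f x"] by linarith
  have "(\<lambda>n. integral {a..} (\<lambda>x. if x \<in> {a..X n} then f x else 0)) \<longlonglongrightarrow> integral {a..} f"
  proof (rule dominated_convergence(2)[OF _ h])
    show "(\<lambda>x. if x \<in> {a..X n} then f x else 0) integrable_on {a..}" for n
    proof -
      have "f integrable_on {a..X n}"
        by (intro integrable_continuous_interval continuous_on_subset[OF f]) auto
      moreover have "{a..X n} \<inter> {a..} = {a..X n}" by auto
      ultimately show ?thesis by (simp only: integrable_restrict_Int)
    qed
    show "norm (if x \<in> {a..X n} then f x else 0) \<le> h x" if "x \<in> {a..}" for n x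
      using le[of x] h0[of x] that by auto
    show "(\<lambda>n. if x \<in> {a..X n} then f x else 0) \<longlonglongrightarrow> f x" if "x \<in> {a..}" for x
    proof (rule tendsto_eventually)
      have "eventually (\<lambda>n. X n \<ge> x) sequentially"
        using X by (simp add: filterlim_at_top)
      thus "eventually (\<lambda>n. (if x \<in> {a..X n} then f x else 0) = f x) sequentially"
        by eventually_elim (use that in auto)
    qed
  qed
  moreover have "integral {a..} (\<lambda>x. if x \<in> {a..X n} then f x else 0) = integral {a..X n} f" for n
  proof -
    have "{a..X n} \<inter> {a..} = {a..X n}" by auto
    thus ?thesis by (simp only: Henstock_Kurzweil_Integration.integral_restrict_Int)
  qed
  ultimately show "(\<lambda>n. integral {a..X n} f) \<longlonglongrightarrow> integral {a..} f" by simp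
qed

lemma sum_power_div_fact_le_exp:
  fixes x :: real
  assumes "x \<ge> 0"
  shows "(\<Sum>n<N. x ^ n / fact n) \<le> exp x"
  using sum_le_suminf[OF summable_exp[of x], of "{..<N}"] assms
  by (simp add: exp_def divide_inverse_commute)

text \<open>The partial sums of the exponential series are dominated by
  \<open>exp (norm w * r)\<close>, which stays integrable against the decaying factor, so summation
  and integration commute.\<close>

lemma exp_integral_sums:
  fixes \<alpha> :: real and w :: complex
  assumes "\<alpha> > 1"
  shows "(\<lambda>n. w ^ n / fact n * of_real (\<alpha> powr ((real n + 1) / \<alpha> - 1) * Gamma ((real n + 1) / \<alpha>))) sums
           integral {0..} (\<lambda>r. exp (w * of_real r) * of_real (exp (- (r powr \<alpha> / \<alpha>))))"
proof -
  define I where "I = (\<lambda>n. \<alpha> powr ((real n + 1) / \<alpha> - 1) * Gamma ((real n + 1) / \<alpha>))"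
  define e where "e = (\<lambda>r. exp (- (r powr \<alpha> / \<alpha>)))"
  have partial: "((\<lambda>r. \<Sum>n<N. w ^ n / fact n * of_real (r ^ n * e r)) has_integral
                    (\<Sum>n<N. w ^ n / fact n * of_real (I n))) {0..}" for N
    unfolding I_def e_def
    by (intro has_integral_sum has_integral_mult_right finite_lessThan has_integral_of_real
          has_integral_power_exp_Gamma) (use assms in auto)
  have "(\<lambda>N. integral {0..} (\<lambda>r. \<Sum>n<N. w ^ n / fact n * of_real (r ^ n * e r)))
          \<longlonglongrightarrow> integral {0..} (\<lambda>r. exp (w * of_real r) * of_real (e r))"
  proof (rule dominated_convergence(2)[OF _ integrable_exp_minus_powr[OF assms, of "norm w"]])
    show "(\<lambda>r. \<Sum>n<N. w ^ n / fact n * of_real (r ^ n * e r)) integrable_on {0..}" for N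
      using partial by blast
  next
    fix N and r :: real assume "r \<in> {0..}"
    hence r: "r \<ge> 0" by simp
    have "norm (\<Sum>n<N. w ^ n / fact n * of_real (r ^ n * e r))
            \<le> (\<Sum>n<N. norm (w ^ n / fact n * of_real (r ^ n * e r)))" by (rule norm_sum)
    also have "\<dots> = (\<Sum>n<N. (norm w * r) ^ n / fact n) * e r"
      unfolding sum_distrib_right using r
      by (intro sum.cong refl) (simp add: norm_mult norm_divide norm_power e_def power_mult_distrib)
    also have "\<dots> \<le> exp (norm w * r) * e r"
      using r by (intro mult_right_mono sum_power_div_fact_le_exp) (auto simp: e_def)
    finally show "norm (\<Sum>n<N. w ^ n / fact n * of_real (r ^ n * e r)) \<le> exp (norm w * r - r powr \<alpha> / \<alpha>)"
      by (simp add: e_def exp_diff exp_minus divide_inverse)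
  next
    fix r :: real
    have "(\<lambda>n. (w * of_real r) ^ n /\<^sub>R fact n * of_real (e r)) sums (exp (w * of_real r) * of_real (e r))"
      by (intro sums_mult2 exp_converges)
    moreover have "(w * of_real r) ^ n /\<^sub>R fact n * of_real (e r) = w ^ n / fact n * of_real (r ^ n * e r)" for n
      by (simp add: scaleR_conv_of_real power_mult_distrib divide_inverse mult_ac)
    ultimately show "(\<lambda>N. \<Sum>n<N. w ^ n / fact n * of_real (r ^ n * e r))
                       \<longlonglongrightarrow> exp (w * of_real r) * of_real (e r)"
      by (simp add: sums_def)
  qed
  thus ?thesis
    unfolding integral_unique[OF partial] sums_def by (simp add: I_def e_def)
qed

section \<open>Power series of the Airy function\<close>

lemma gen_airy_sums:
  fixes \<alpha> y :: real
  assumes "\<alpha> > 1"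
  shows "(\<lambda>n. \<alpha> powr ((real n + 1) / \<alpha> - 1) * y ^ n * (Gamma ((real n + 1) / \<alpha>) / fact n) *
             sin (pi * ((real n + 1) * (\<alpha> + 1) / (2 * \<alpha>)))) sums (pi * gen_airy \<alpha> y)"
proof -
  define \<theta> where "\<theta> = pi / (2 * \<alpha>)"
  \<comment> \<open>The coefficient of r in \<open>\<i> * y * z\<close> at the point
    \<open>z = r * cis \<theta>\<close> of the ray.\<close>
  define w where "w = \<i> * of_real y * cis \<theta>"
  define J where "J = integral {0..} (\<lambda>r. exp (w * of_real r) * of_real (exp (- (r powr \<alpha> / \<alpha>))))"
  have "((\<lambda>R. integral {0..R} (\<lambda>r. exp (w * of_real r) * of_real (exp (- (r powr \<alpha> / \<alpha>))))) \<longlongrightarrow> J) at_top"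
    unfolding J_def
  proof (rule integral_tendsto_at_top_dominated)
    show "continuous_on {0..} (\<lambda>r. exp (w * of_real r) * of_real (exp (- (r powr \<alpha> / \<alpha>))))"
      by (intro continuous_intros continuous_on_powr') (use assms in auto)
    show "(\<lambda>r. exp (norm w * r - r powr \<alpha> / \<alpha>)) integrable_on {0..}"
      by (rule integrable_exp_minus_powr[OF assms])
    show "norm (exp (w * of_real r) * of_real (exp (- (r powr \<alpha> / \<alpha>)))) \<le> exp (norm w * r - r powr \<alpha> / \<alpha>)"
      if "r \<ge> 0" for r
    proof -
      have "exp (Re w * r) \<le> exp (norm w * r)"
        using that complex_Re_le_cmod[of w] by (simp add: mult_right_mono)
      thus ?thesis
        by (simp add: norm_mult exp_diff exp_minus divide_inverse mult_right_mono del: exp_le_cancel_iff flip: of_real_inverse)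
    qed
  qed
  also have "(\<lambda>R. integral {0..R} (\<lambda>r. exp (w * of_real r) * of_real (exp (- (r powr \<alpha> / \<alpha>))))) =
             (\<lambda>R. integral {0..R} (\<lambda>r. airy_kernel \<alpha> y (of_real r * cis \<theta>)))"
    by (intro ext integral_cong) (simp add: airy_kernel_on_ray[OF assms] w_def \<theta>_def)
  finally have "((\<lambda>R. cis \<theta> * integral {0..R} (\<lambda>r. airy_kernel \<alpha> y (of_real r * cis \<theta>))
             - integral {0..\<theta>} (\<lambda>\<phi>. \<i> * of_real R * cis \<phi> * airy_kernel \<alpha> y (of_real R * cis \<phi>)))
             \<longlongrightarrow> cis \<theta> * J - 0) at_top"
    using airy_kernel_arc_tendsto_0[OF assms, folded \<theta>_def] by (intro tendsto_intros)
  moreover have "eventually (\<lambda>R. cis \<theta> * integral {0..R} (\<lambda>r. airy_kernel \<alpha> y (of_real r * cis \<theta>))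
             - integral {0..\<theta>} (\<lambda>\<phi>. \<i> * of_real R * cis \<phi> * airy_kernel \<alpha> y (of_real R * cis \<phi>))
             = integral {0..R} (\<lambda>s. airy_kernel \<alpha> y (of_real s))) at_top"
    \<comment> \<open>The rotation identity is available only for nonnegative R, hence an eventual
      equality.\<close>
    using eventually_ge_at_top[of 0]
    by eventually_elim (simp add: airy_kernel_rotate[OF assms] \<theta>_def)
  ultimately have "((\<lambda>R. integral {0..R} (\<lambda>s. airy_kernel \<alpha> y (of_real s))) \<longlongrightarrow> cis \<theta> * J) at_top"
    by (auto intro: Lim_transform_eventually)
  hence "((\<lambda>R. Re (integral {0..R} (\<lambda>s. airy_kernel \<alpha> y (of_real s)))) \<longlongrightarrow> Re (cis \<theta> * J)) at_top"
    by (rule tendsto_Re)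
  also have "(\<lambda>R. Re (integral {0..R} (\<lambda>s. airy_kernel \<alpha> y (of_real s)))) =
             (\<lambda>R. integral {0..R} (\<lambda>s. cos (s * y + s powr \<alpha> / \<alpha>)))"
  proof
    fix R :: real
    have "(\<lambda>s. airy_kernel \<alpha> y (of_real s)) integrable_on {0..R}"
      by (intro integrable_continuous_interval continuous_on_compose2[OF continuous_on_airy_kernel])
         (use assms in \<open>auto intro!: continuous_intros\<close>)
    hence "Re (integral {0..R} (\<lambda>s. airy_kernel \<alpha> y (of_real s))) =
             integral {0..R} (\<lambda>s. Re (airy_kernel \<alpha> y (of_real s)))"
      by (simp add: integral_linear[OF _ bounded_linear_Re, unfolded o_def])
    also have "\<dots> = integral {0..R} (\<lambda>s. cos (s * y + s powr \<alpha> / \<alpha>))"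
      by (intro integral_cong) (simp add: airy_kernel_def powr_of_real Re_exp mult.commute)
    finally show "Re (integral {0..R} (\<lambda>s. airy_kernel \<alpha> y (of_real s))) =
             integral {0..R} (\<lambda>s. cos (s * y + s powr \<alpha> / \<alpha>))" .
  qed
  \<comment> \<open>The convergence just proved is what lets the \<open>Lim\<close> in
    \<open>gen_airy\<close> be evaluated.\<close>
  finally have airy: "pi * gen_airy \<alpha> y = Re (cis \<theta> * J)"
    unfolding gen_airy_def by (subst tendsto_Lim) auto
  have "(\<lambda>n. Re (cis \<theta> * (w ^ n / fact n * of_real (\<alpha> powr ((real n + 1) / \<alpha> - 1) * Gamma ((real n + 1) / \<alpha>)))))
          sums Re (cis \<theta> * J)"
    unfolding J_def by (intro sums_Re sums_mult exp_integral_sums assms)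
  moreover have "Re (cis \<theta> * (w ^ n / fact n * of_real (\<alpha> powr ((real n + 1) / \<alpha> - 1) * Gamma ((real n + 1) / \<alpha>)))) =
      \<alpha> powr ((real n + 1) / \<alpha> - 1) * y ^ n * (Gamma ((real n + 1) / \<alpha>) / fact n) *
             sin (pi * ((real n + 1) * (\<alpha> + 1) / (2 * \<alpha>)))" for n
  proof -
    have "\<i> * cis \<theta> = cis (pi / 2 + \<theta>)" by (simp add: cis_mult flip: cis_pi_half)
    \<comment> \<open>Writing \<open>cis \<theta>\<close> as
      \<open>- \<i> * (\<i> * cis \<theta>)\<close> merges all rotations into one power with
      exponent n + 1; the leftover factor \<open>- \<i>\<close> turns the real part into a
      sine.\<close>
    moreover have "cis \<theta> * (\<i> * cis \<theta>) ^ n = - \<i> * (\<i> * cis \<theta>) ^ Suc n"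
      by (simp flip: mult.assoc)
    ultimately have "cis \<theta> * (\<i> * cis \<theta>) ^ n = - \<i> * cis (pi / 2 + \<theta>) ^ Suc n"
      by (simp only:)
    also have "\<dots> = - \<i> * cis (real (Suc n) * (pi / 2 + \<theta>))" by (simp only: Complex.DeMoivre)
    also have "real (Suc n) * (pi / 2 + \<theta>) = pi * ((real n + 1) * (\<alpha> + 1) / (2 * \<alpha>))"
      using assms by (simp add: \<theta>_def field_simps)
    finally have rotation: "cis \<theta> * (\<i> * cis \<theta>) ^ n =
        - \<i> * cis (pi * ((real n + 1) * (\<alpha> + 1) / (2 * \<alpha>)))" .
    have "cis \<theta> * w ^ n = of_real (y ^ n) * (cis \<theta> * (\<i> * cis \<theta>) ^ n)"
      by (simp add: w_def power_mult_distrib)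
    also note rotation
    finally have w: "cis \<theta> * w ^ n =
        of_real (y ^ n) * (- \<i> * cis (pi * ((real n + 1) * (\<alpha> + 1) / (2 * \<alpha>))))" .
    have "cis \<theta> * (w ^ n / fact n * of_real I) = of_real (I / fact n) * (cis \<theta> * w ^ n)" for I
      by simp
    hence "Re (cis \<theta> * (w ^ n / fact n * of_real I)) =
        I / fact n * y ^ n * sin (pi * ((real n + 1) * (\<alpha> + 1) / (2 * \<alpha>)))" for I
      unfolding w by (simp del: of_real_divide of_real_power)
    thus ?thesis by (simp del: of_real_mult)
  qed
  ultimately show ?thesis unfolding airy by simp
qed

section \<open>Even part and rescaling\<close>

text \<open>Summability is asserted as well, because the infinite sum denotes the limit of its
  partial sums only when that limit exists.\<close>

theorem mainTheorem4:
  fixes \<alpha> x t :: real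
  assumes "\<alpha> > 1" and "t > 0"
  shows "summable (\<lambda>k::nat. (x / t powr (1 / \<alpha>)) ^ (2 * k) *
             (Gamma ((2 * real k + 1) / \<alpha>) / fact (2 * k)) *
             sin (pi * ((2 * real k + 1) * (\<alpha> + 1) / (2 * \<alpha>)))) \<and>
         u_even \<alpha> x t =
           1 / (\<alpha> * pi * t powr (1 / \<alpha>)) *
             (\<Sum>k::nat. (x / t powr (1 / \<alpha>)) ^ (2 * k) *
               (Gamma ((2 * real k + 1) / \<alpha>) / fact (2 * k)) *
               sin (pi * ((2 * real k + 1) * (\<alpha> + 1) / (2 * \<alpha>))))"
proof -
  define c where "c = (\<alpha> * t) powr (1 / \<alpha>)"
  define A where "A = gen_airy \<alpha> (x / c) + gen_airy \<alpha> (- x / c)"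
  define a where "a = (\<lambda>n. \<alpha> powr ((real n + 1) / \<alpha> - 1) * (Gamma ((real n + 1) / \<alpha>) / fact n) *
             sin (pi * ((real n + 1) * (\<alpha> + 1) / (2 * \<alpha>))))"
  define T where "T = (\<lambda>k. (x / t powr (1 / \<alpha>)) ^ (2 * k) *
             (Gamma ((2 * real k + 1) / \<alpha>) / fact (2 * k)) *
             sin (pi * ((2 * real k + 1) * (\<alpha> + 1) / (2 * \<alpha>))))"
  have c: "c = \<alpha> powr (1 / \<alpha>) * t powr (1 / \<alpha>)"
    using assms by (simp add: c_def powr_mult)
  have "(\<lambda>n. a n * (x / c) ^ n + a n * (- x / c) ^ n) sums (pi * gen_airy \<alpha> (x / c) + pi * gen_airy \<alpha> (- x / c))"
    using sums_add[OF gen_airy_sums[OF assms(1), of "x / c"] gen_airy_sums[OF assms(1), of "- x / c"]]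
    by (simp add: a_def mult_ac)
  hence "(\<lambda>n. a n * ((x / c) ^ n + (- (x / c)) ^ n)) sums (pi * A)"
    by (simp add: A_def distrib_left)
  \<comment> \<open>Odd powers cancel, so the nonzero terms sit on the range of the strictly
    increasing map \<open>k \<mapsto> 2 * k\<close>.\<close>
  hence "(\<lambda>k. a (2 * k) * ((x / c) ^ (2 * k) + (- (x / c)) ^ (2 * k))) sums (pi * A)"
  proof (subst sums_mono_reindex[of "\<lambda>k. 2 * k" "\<lambda>n. a n * ((x / c) ^ n + (- (x / c)) ^ n)"])
    fix n :: nat assume "n \<notin> range (\<lambda>k. 2 * k)"
    hence "odd n" by (auto elim!: evenE)
    thus "a n * ((x / c) ^ n + (- (x / c)) ^ n) = 0" by simp
  qed (auto simp: strict_mono_def)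
  \<comment> \<open>The power \<open>\<alpha> powr (2 * k / \<alpha>)\<close> from the Gamma
    integral cancels the one hidden in \<open>c ^ (2 * k)\<close>, leaving a constant independent of
    k.\<close>
  moreover have "a (2 * k) * ((x / c) ^ (2 * k) + (- (x / c)) ^ (2 * k)) = 2 * \<alpha> powr (1 / \<alpha> - 1) * T k" for k
  proof -
    have "(\<alpha> powr (1 / \<alpha>)) ^ (2 * k) = \<alpha> powr (2 * real k / \<alpha>)"
      using assms(1) by (simp add: powr_powr flip: powr_realpow)
    hence "(x / c) ^ (2 * k) = (x / t powr (1 / \<alpha>)) ^ (2 * k) / \<alpha> powr (2 * real k / \<alpha>)"
      by (simp add: c power_divide power_mult_distrib)
    moreover have "\<alpha> powr ((2 * real k + 1) / \<alpha> - 1) = \<alpha> powr (1 / \<alpha> - 1) * \<alpha> powr (2 * real k / \<alpha>)"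
      unfolding powr_add[symmetric] by (rule arg_cong) (simp add: add_divide_distrib)
    ultimately show ?thesis
      using assms(1) by (simp add: a_def T_def)
  qed
  ultimately have "(\<lambda>k. 2 * \<alpha> powr (1 / \<alpha> - 1) * T k) sums (pi * A)" by (simp only:)
  from sums_divide[OF this, of "2 * \<alpha> powr (1 / \<alpha> - 1)"]
  have T: "T sums (pi * A / (2 * \<alpha> powr (1 / \<alpha> - 1)))"
    using assms(1) by simp
  have "u_even \<alpha> x t = 1 / (2 * c) * A"
    by (simp add: u_even_def c_def A_def)
  also have "\<dots> = 1 / (\<alpha> * pi * t powr (1 / \<alpha>)) * (pi * A / (2 * \<alpha> powr (1 / \<alpha> - 1)))"
  proof -
    \<comment> \<open>Since \<open>\<alpha> * q = \<alpha> powr (1 / \<alpha>)\<close>, the scale c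
      contains q and cancels the q in the series constant up to \<alpha>.\<close>
    define q where "q = \<alpha> powr (1 / \<alpha> - 1)"
    have "c = \<alpha> * q * t powr (1 / \<alpha>)" "q > 0"
      using assms powr_mult_base[of \<alpha> "1 / \<alpha> - 1"] by (auto simp: c q_def)
    thus ?thesis using assms by (simp flip: q_def)
  qed
  finally show ?thesis
    using T unfolding T_def by (simp add: sums_iff)
qed

end
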